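(* Let $X$ be a real Hilbert space, and let $A:X\to X$ be a potential operator, with sequentially weakly upper semicontinuous potential $P:X\to\mathbb{R}$ satisfying $$\liminf_{r\to +\infty}\frac{\sup_{\|x\|\leq r}P(x)}{r^2}<\frac{1}{2}<\limsup_{r\to +\infty}\frac{\sup_{\|x\|\leq r}P(x)}{r^2}.$$ Then the set of all fixed points of $A$ is unbounded.
   Context: Given a real Hilbert space $X$, an operator $A:X\to X$ is said to be a potential operator if there exists a Gâteaux differentiable functional $P:X\to\mathbb{R}$ (called a potential of $A$) such that $P'=A$ (the Gâteaux derivative being identified with an element of $X$ via the Riesz representation). No further continuity is assumed on $A$. *)

theory Defs
  imports "HOL-Analysis.Analysis"
begin

definition has_gateaux_derivative ::
    "('a::real_normed_vector \<Rightarrow> real) \<Rightarrow> ('a \<Rightarrow> real) \<Rightarrow> 'a \<Rightarrow> bool" where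
  "has_gateaux_derivative f L x \<longleftrightarrow>
     bounded_linear L \<and>
     (\<forall>h. ((\<lambda>t::real. (f (x + t *\<^sub>R h) - f x) / t) \<longlongrightarrow> L h) (at 0))"

text \<open>The derivative, a bounded linear functional, is represented by the vector \<open>A x\<close> through
  the Riesz identification.\<close>

definition potential_of :: "('a::real_inner \<Rightarrow> real) \<Rightarrow> ('a \<Rightarrow> 'a) \<Rightarrow> bool" where
  "potential_of P A \<longleftrightarrow> (\<forall>x. has_gateaux_derivative P (\<lambda>h. inner (A x) h) x)"

definition potential_operator :: "('a::real_inner \<Rightarrow> 'a) \<Rightarrow> bool" where
  "potential_operator A \<longleftrightarrow> (\<exists>P. potential_of P A)"

definition weakly_converges :: "(nat \<Rightarrow> 'a::real_normed_vector) \<Rightarrow> 'a \<Rightarrow> bool" where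
  "weakly_converges u x \<longleftrightarrow>
     (\<forall>f :: 'a \<Rightarrow> real. bounded_linear f \<longrightarrow> (\<lambda>n. f (u n)) \<longlonglongrightarrow> f x)"

definition seq_weakly_usc :: "('a::real_normed_vector \<Rightarrow> real) \<Rightarrow> bool" where
  "seq_weakly_usc P \<longleftrightarrow>
     (\<forall>u x. weakly_converges u x \<longrightarrow> limsup (\<lambda>n. ereal (P (u n))) \<le> ereal (P x))"

text \<open>Values in \<open>ereal\<close>, so that neither the supremum nor the upper and lower limits
  presuppose boundedness.\<close>

definition sup_growth :: "('a::real_normed_vector \<Rightarrow> real) \<Rightarrow> real \<Rightarrow> ereal" where
  "sup_growth P r = (SUP x\<in>{x. norm x \<le> r}. ereal (P x)) / ereal (r\<^sup>2)"

end

theory Submission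
  imports Defs "HOL-Complex_Analysis.Great_Picard"
begin

text \<open>
  A fixed point of \<open>A\<close> is a critical point of \<open>Q x = P x - (norm x)\<^sup>2 / 2\<close>, whose gradient is
  \<open>A x - x\<close>. The upper growth hypothesis makes \<open>Q\<close> unbounded above: on balls of suitable large
  radii \<open>r\<close>, some point has \<open>P\<close> above \<open>c' r\<^sup>2\<close> with \<open>c' > 1/2\<close>, and \<open>(norm x)\<^sup>2 / 2\<close> is at most
  \<open>r\<^sup>2 / 2\<close> there. The lower growth hypothesis makes \<open>Q\<close> very negative on certain large spheres:
  for other large radii \<open>r\<close>, \<open>P \<le> c r\<^sup>2\<close> on the ball with \<open>c < 1/2\<close>, hence
  \<open>Q \<le> (c - 1/2) r\<^sup>2\<close> on the sphere. A maximiser of \<open>Q\<close> on such a ball is therefore interior, so it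
  is a fixed point of \<open>A\<close>, and the values of \<open>Q\<close> at the fixed points found in this way are
  arbitrarily large. Since \<open>Q\<close> is bounded above on every ball, these fixed points leave every ball.

  That \<open>Q\<close> attains its maximum on closed balls
  (\<open>seq_weakly_usc_attains_max_on_cball\<close>) follows from the direct method: \<open>Q\<close> is sequentially
  weakly upper semicontinuous, and bounded sequences in a Hilbert space have weakly convergent
  subsequences (\<open>bounded_imp_weakly_convergent_subsequence\<close>). The weak limit is found geometrically,
  as a common point of the closed convex hulls of the tails of the sequence. Such a point exists
  by the parallelogram law, and testing it with any bounded linear functional whose values along
  the sequence converge returns the limit of these values.
\<close>

section \<open>Weak sequential compactness of bounded sets\<close>

text \<open>
  The distances from the origin to the sets \<open>C n\<close> increase to a finite limit. Points that nearly
  realise these distances form a Cauchy sequence: the midpoint of the \<open>n\<close>-th and \<open>m\<close>-th point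
  (\<open>n \<le> m\<close>) lies in \<open>C n\<close> by convexity, so its norm cannot fall below the distance to
  \<open>C n\<close>, and the parallelogram law then bounds the difference of the two points.
\<close>

lemma nested_bounded_convex_closures_intersect:
  fixes C :: "nat \<Rightarrow> 'a::{real_inner, complete_space} set"
  assumes dec: "\<And>m n. m \<le> n \<Longrightarrow> C n \<subseteq> C m"
    and conv: "\<And>n. convex (C n)"
    and ne: "\<And>n. C n \<noteq> {}"
    and bnd: "bounded (C 0)"
  shows "\<exists>z. \<forall>n. z \<in> closure (C n)"
proof -
  define d where "d n = Inf (norm ` C n)" for n
  have bdd: "bdd_below (norm ` C n)" for n
    by (rule bdd_belowI[of _ 0]) auto
  have d_le: "d n \<le> norm x" if "x \<in> C n" for n x
    unfolding d_def using that bdd by (auto intro: cInf_lower)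
  obtain B where B: "\<And>x. x \<in> C 0 \<Longrightarrow> norm x \<le> B"
    using bnd by (auto simp: bounded_iff)
  have d0: "0 \<le> d n" for n
    unfolding d_def using ne by (auto intro!: cInf_greatest)
  have dB: "d n \<le> B" for n
  proof -
    obtain x where "x \<in> C n" using ne by blast
    then show ?thesis using d_le[of x n] B[of x] dec[of 0 n] by force
  qed
  have "incseq d"
  proof (rule incseq_SucI)
    fix n show "d n \<le> d (Suc n)"
      unfolding d_def
      by (rule cInf_superset_mono) (use ne bdd dec[of n "Suc n"] in auto)
  qed
  then obtain L where L: "d \<longlonglongrightarrow> L"
    using incseq_convergent[of d B] dB by blast
  define e where "e n = 1 / real (Suc n)" for n
  have e_pos: "0 < e n" for n by (simp add: e_def)
  have e_lim: "e \<longlonglongrightarrow> 0"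
    unfolding e_def using LIMSEQ_inverse_real_of_nat by (simp add: inverse_eq_divide)
  have "\<exists>x\<in>C n. norm x < d n + e n" for n
    using cInf_lessD[of "norm ` C n" "d n + e n"] ne e_pos[of n] by (auto simp: d_def)
  then obtain z where zC: "\<And>n. z n \<in> C n" and z: "\<And>n. norm (z n) < d n + e n"
    by metis
  have gap: "(norm (z n - z m))\<^sup>2 \<le> 2 * (d n + e n)\<^sup>2 + 2 * (d m + e m)\<^sup>2 - 4 * (d n)\<^sup>2"
    if "n \<le> m" for n m
  proof -
    have "(1/2) *\<^sub>R z n + (1/2) *\<^sub>R z m \<in> C n"
      by (rule convexD[OF conv]) (use zC dec[OF that] in auto)
    then have "d n \<le> norm ((1/2) *\<^sub>R (z n + z m))"
      using d_le by (simp add: scaleR_add_right)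
    then have "2 * d n \<le> norm (z n + z m)" by simp
    then have "(2 * d n)\<^sup>2 \<le> (norm (z n + z m))\<^sup>2"
      using d0[of n] by (intro power_mono) auto
    moreover have "(norm (z n - z m))\<^sup>2 + (norm (z n + z m))\<^sup>2 = 2 * (norm (z n))\<^sup>2 + 2 * (norm (z m))\<^sup>2"
      by (simp add: power2_norm_eq_inner inner_simps inner_commute)
    moreover have "(norm (z k))\<^sup>2 \<le> (d k + e k)\<^sup>2" for k
      using z[of k] by (intro power_mono) auto
    from this[of n] this[of m] have
      "2 * (norm (z n))\<^sup>2 + 2 * (norm (z m))\<^sup>2 \<le> 2 * (d n + e n)\<^sup>2 + 2 * (d m + e m)\<^sup>2" by linarith
    ultimately show ?thesis by (simp add: power_mult_distrib)
  qed
  have "Cauchy z"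
  proof (rule CauchyI')
    fix \<epsilon> :: real assume \<epsilon>: "\<epsilon> > 0"
    define p where "p n = (d n + e n)\<^sup>2" for n
    have pl: "p \<longlonglongrightarrow> L\<^sup>2" unfolding p_def
      using tendsto_power[OF tendsto_add[OF L e_lim], of 2] by simp
    have ql: "(\<lambda>n. (d n)\<^sup>2) \<longlonglongrightarrow> L\<^sup>2" using tendsto_power[OF L] .
    have pos: "\<epsilon>\<^sup>2 / 8 > 0" using \<epsilon> by simp
    have "\<forall>\<^sub>F n in sequentially. p n < L\<^sup>2 + \<epsilon>\<^sup>2 / 8 \<and> (d n)\<^sup>2 > L\<^sup>2 - \<epsilon>\<^sup>2 / 8"
      by (intro eventually_conj order_tendstoD(2)[OF pl] order_tendstoD(1)[OF ql]) (use pos in auto)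
    then obtain N where N: "\<And>n. n \<ge> N \<Longrightarrow> p n < L\<^sup>2 + \<epsilon>\<^sup>2 / 8 \<and> (d n)\<^sup>2 > L\<^sup>2 - \<epsilon>\<^sup>2 / 8"
      by (auto simp: eventually_sequentially)
    have "dist (z m) (z n) < \<epsilon>" if "m \<ge> N" "n > m" for m n
    proof -
      have "(norm (z m - z n))\<^sup>2 \<le> 2 * p m + 2 * p n - 4 * (d m)\<^sup>2"
        using gap[of m n] that by (simp add: p_def)
      also have "\<dots> < \<epsilon>\<^sup>2" using N[of m] N[of n] that by linarith
      finally show ?thesis using \<epsilon> by (simp add: dist_norm power2_less_imp_less)
    qed
    then show "\<exists>M. \<forall>m\<ge>M. \<forall>n>m. dist (z m) (z n) < \<epsilon>" by blast
  qed
  then obtain w where w: "z \<longlonglongrightarrow> w"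
    using Cauchy_convergent convergent_def by blast
  have "w \<in> closure (C n)" for n
  proof (rule Lim_in_closed_set[OF closed_closure _ _ w])
    show "\<forall>\<^sub>F k in sequentially. z k \<in> closure (C n)"
      unfolding eventually_sequentially using zC dec closure_subset by blast
  qed auto
  then show ?thesis by blast
qed

text \<open>A closed half-space is closed and convex, so it contains the closed convex hull of each of its subsets.\<close>

lemma bounded_linear_le_on_closed_convex_hull:
  fixes f :: "'a::real_normed_vector \<Rightarrow> real"
  assumes f: "bounded_linear f" and S: "\<And>y. y \<in> S \<Longrightarrow> f y \<le> c"
    and z: "z \<in> closure (convex hull S)"
  shows "f z \<le> c"
proof -
  interpret bounded_linear f by fact
  have eq: "{y. f y \<le> c} = f -` {..c}" by auto
  have "closed {y. f y \<le> c}"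
    by (rule closed_Collect_le) (simp_all add: linear_continuous_on f)
  moreover have "convex {y. f y \<le> c}"
    unfolding eq by (rule convex_linear_vimage) (auto simp: linear_axioms)
  ultimately have "closure (convex hull S) \<subseteq> {y. f y \<le> c}"
    by (intro closure_minimal hull_minimal) (use S in auto)
  with z show ?thesis by auto
qed

definition tail_hull :: "(nat \<Rightarrow> 'a::real_normed_vector) \<Rightarrow> nat \<Rightarrow> 'a set" where
  "tail_hull u n = closure (convex hull (u ` {n..}))"

text \<open>
  If \<open>f\<close> is within \<open>e\<close> of \<open>l\<close> along a tail of \<open>u\<close>, it stays so on the closed convex hull of
  that tail, which contains \<open>z\<close>. Points common to all tail hulls thus play the role of weak limits.
\<close>

lemma functional_at_tail_hull_point:
  fixes f :: "'a::real_normed_vector \<Rightarrow> real"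
  assumes f: "bounded_linear f" and lim: "(\<lambda>n. f (u n)) \<longlonglongrightarrow> l"
    and z: "\<And>n. z \<in> tail_hull u n"
  shows "f z = l"
proof (rule antisym)
  have upper: "g z \<le> k" if g: "bounded_linear g" and k: "(\<lambda>n. g (u n)) \<longlonglongrightarrow> k" for g :: "'a \<Rightarrow> real" and k
  proof (rule field_le_epsilon)
    fix e :: real assume "e > 0"
    then have "\<forall>\<^sub>F n in sequentially. g (u n) < k + e"
      using order_tendstoD(2)[OF k] by simp
    then obtain N where N: "\<And>n. n \<ge> N \<Longrightarrow> g (u n) < k + e"
      by (auto simp: eventually_sequentially)
    show "g z \<le> k + e"
      by (rule bounded_linear_le_on_closed_convex_hull[OF g _ z[of N, unfolded tail_hull_def]])
        (use N in \<open>auto intro: less_imp_le\<close>)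
  qed
  show "f z \<le> l" by (rule upper[OF f lim])
  have "- f z \<le> - l"
    by (rule upper[of "\<lambda>x. - f x"]) (auto intro: bounded_linear_minus f tendsto_minus lim)
  then show "l \<le> f z" by simp
qed

lemma bounded_imp_tail_hull_point:
  fixes u :: "nat \<Rightarrow> 'a::{real_inner, complete_space}"
  assumes "bounded (range u)"
  shows "\<exists>z. \<forall>n. z \<in> tail_hull u n"
  unfolding tail_hull_def
proof (rule nested_bounded_convex_closures_intersect)
  show "convex hull (u ` {n..}) \<subseteq> convex hull (u ` {m..})" if "m \<le> n" for m n
    using that by (intro hull_mono) auto
  show "bounded (convex hull (u ` {0..}))"
    using assms by (intro bounded_convex_hull) (simp add: atLeast_0)
qed (auto simp: convex_convex_hull)

text \<open>
  A diagonal argument gives a subsequence \<open>v\<close> along which the inner product with each member of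
  the sequence converges. A common point of the tail hulls of any subsequence of \<open>v\<close> has prescribed
  inner products with all \<open>v m\<close> and lies in their closed convex hull, which determines it
  uniquely as one vector \<open>z\<close>. If a functional \<open>f\<close> failed to converge to \<open>f z\<close>
  along \<open>v\<close>, some subsequence would have values of \<open>f\<close> converging to a limit other than \<open>f z\<close>;
  but its own tail-hull point is again \<open>z\<close>, where \<open>f\<close> must equal that limit.
\<close>

lemma bounded_imp_weakly_convergent_subsequence:
  fixes u :: "nat \<Rightarrow> 'a::{real_inner, complete_space}"
  assumes bnd: "bounded (range u)"
  shows "\<exists>s z. strict_mono s \<and> weakly_converges (u \<circ> s) z"
proof -
  obtain B where B: "\<And>n. norm (u n) \<le> B" using bnd by (auto simp: bounded_iff)
  have "norm (inner (u n) x) \<le> B * B" if "x \<in> range u" for n x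
  proof -
    have "norm (inner (u n) x) \<le> norm (u n) * norm x"
      using Cauchy_Schwarz_ineq2[of "u n" x] by simp
    also have "\<dots> \<le> B * B"
      using B that order_trans[OF norm_ge_zero B] by (intro mult_mono) auto
    finally show ?thesis .
  qed
  then obtain s where s: "strict_mono s"
    and conv: "\<And>x. x \<in> range u \<Longrightarrow> \<exists>l. (\<lambda>n. inner (u (s n)) x) \<longlonglongrightarrow> l"
    using function_convergent_subsequence[of "range u" "\<lambda>n x. inner (u n) x" "B * B"]
      countable_image[of UNIV u] by (metis countableI_type)
  define v where "v = u \<circ> s"
  have bv: "bounded (range (v \<circ> t))" for t
    using bnd by (rule bounded_subset) (auto simp: v_def)
  obtain z where z: "\<And>n. z \<in> tail_hull v n"
    using bounded_imp_tail_hull_point[of v] bv[of id] by auto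
  have unique: "z' = z" if t: "strict_mono t" and z': "\<And>n. z' \<in> tail_hull (v \<circ> t) n" for t z'
  proof -
    have orth: "inner (z - z') (v m) = 0" for m
    proof -
      obtain l where l: "(\<lambda>n. inner (v n) (v m)) \<longlonglongrightarrow> l"
        using conv[of "v m"] by (auto simp: v_def)
      have "inner z (v m) = l"
        by (rule functional_at_tail_hull_point[OF bounded_linear_inner_left l z])
      moreover have "inner z' (v m) = l"
        using functional_at_tail_hull_point[OF bounded_linear_inner_left _ z']
          LIMSEQ_subseq_LIMSEQ[OF l t] by (simp add: o_def)
      ultimately show ?thesis by (simp add: inner_diff_left)
    qed
    have "tail_hull (v \<circ> t) 0 \<subseteq> tail_hull v 0"
      unfolding tail_hull_def by (intro closure_mono hull_mono) auto
    then have z'0: "z' \<in> tail_hull v 0" using z' by blast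
    \<comment> \<open>Orthogonality to all \<open>v m\<close> passes to their closed convex hull, which contains both points,
      so \<open>z - z'\<close> is orthogonal to itself.\<close>
    have "inner (z - z') z \<le> 0"
      by (rule bounded_linear_le_on_closed_convex_hull[OF bounded_linear_inner_right _ z[of 0, unfolded tail_hull_def]])
        (auto simp: orth)
    moreover have "inner (z' - z) z' \<le> 0"
      by (rule bounded_linear_le_on_closed_convex_hull[OF bounded_linear_inner_right _ z'0[unfolded tail_hull_def]])
        (use orth in \<open>auto simp: inner_diff_left\<close>)
    ultimately have "inner (z - z') (z - z') \<le> 0"
      by (simp add: inner_simps inner_commute)
    then show ?thesis using inner_gt_zero_iff[of "z - z'"] by (simp add: not_less[symmetric])
  qed
  have "(\<lambda>n. f (v n)) \<longlonglongrightarrow> f z" if f: "bounded_linear f" for f :: "'a \<Rightarrow> real"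
  proof (rule ccontr)
    assume "\<not> ?thesis"
    then obtain e where e: "e > 0" and "\<forall>N. \<exists>n\<ge>N. dist (f (v n)) (f z) \<ge> e"
      unfolding lim_sequentially by (meson not_le)
    then have "\<exists>\<^sub>\<infinity>n. dist (f (v n)) (f z) \<ge> e" by (simp add: INFM_nat_le)
    then obtain t :: "nat \<Rightarrow> nat" where t: "strict_mono t" and far: "\<And>n. dist (f (v (t n))) (f z) \<ge> e"
      using infinite_enumerate[of "{n. dist (f (v n)) (f z) \<ge> e}"]
      unfolding INFM_iff_infinite mem_Collect_eq by blast
    have "bounded (range (\<lambda>n. f (v (t n))))"
      using bounded_linear_image[OF bv[of t] f] by (simp add: image_comp o_def)
    then obtain l t' where t': "strict_mono t'" and l: "((\<lambda>n. f (v (t n))) \<circ> t') \<longlonglongrightarrow> l"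
      using bounded_imp_convergent_subsequence by blast
    obtain z' where z': "\<And>n. z' \<in> tail_hull (v \<circ> (t \<circ> t')) n"
      using bounded_imp_tail_hull_point[OF bv] by blast
    have "z' = z" using unique[OF strict_mono_o[OF t t'] z'] .
    moreover have "f z' = l"
      by (rule functional_at_tail_hull_point[OF f _ z']) (use l in \<open>simp add: o_def\<close>)
    ultimately have "((\<lambda>n. f (v (t n))) \<circ> t') \<longlonglongrightarrow> f z" using l by simp
    then obtain n where "dist (f (v (t (t' n)))) (f z) < e"
      using e unfolding lim_sequentially by auto
    with far show False by (simp add: not_less[symmetric])
  qed
  then show ?thesis using s unfolding weakly_converges_def v_def by (auto simp: o_def)
qed

section \<open>Maximisers and critical points\<close>

text \<open>
  The direct method. A maximising sequence has a weakly convergent subsequence, upper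
  semicontinuity makes its limit a maximiser, and closed balls are weakly sequentially closed.
  The supremum is taken in \<open>ereal\<close>, since its finiteness is only a consequence of being attained.
\<close>

lemma seq_weakly_usc_attains_max_on_cball:
  fixes Q :: "'a::{real_inner, complete_space} \<Rightarrow> real"
  assumes usc: "seq_weakly_usc Q" and r: "0 \<le> r"
  shows "\<exists>z. norm z \<le> r \<and> (\<forall>x. norm x \<le> r \<longrightarrow> Q x \<le> Q z)"
proof -
  define V where "V = (\<lambda>x. ereal (Q x)) ` {x. norm x \<le> r}"
  have "V \<noteq> {}" using r by (auto simp: V_def intro!: exI[of _ 0])
  then obtain w where wV: "\<And>n. w n \<in> V" and w: "w \<longlonglongrightarrow> Sup V"
    using Sup_countable_SUP[of V] LIMSEQ_SUP by (metis range_subsetD)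
  then obtain u where u: "\<And>n. norm (u n) \<le> r" and wu: "\<And>n. w n = ereal (Q (u n))"
  proof -
    have "\<exists>x. norm x \<le> r \<and> w n = ereal (Q x)" for n
      using wV[of n] by (auto simp: V_def)
    then show ?thesis using that by metis
  qed
  have "bounded (range u)" using u by (auto simp: bounded_iff)
  then obtain s z where s: "strict_mono s" and z: "weakly_converges (u \<circ> s) z"
    using bounded_imp_weakly_convergent_subsequence by blast
  have "(\<lambda>n. ereal (Q ((u \<circ> s) n))) \<longlonglongrightarrow> Sup V"
    using LIMSEQ_subseq_LIMSEQ[OF w s] by (simp add: wu o_def)
  then have "Sup V = limsup (\<lambda>n. ereal (Q ((u \<circ> s) n)))"
    by (simp add: lim_imp_Limsup)
  also have "\<dots> \<le> ereal (Q z)"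
    using usc z unfolding seq_weakly_usc_def by blast
  finally have sup: "Sup V \<le> ereal (Q z)" .
  have "(\<lambda>n. inner z ((u \<circ> s) n)) \<longlonglongrightarrow> inner z z"
    using z bounded_linear_inner_right unfolding weakly_converges_def by blast
  moreover have "inner z ((u \<circ> s) n) \<le> norm z * r" for n
    using norm_cauchy_schwarz[of z "u (s n)"] mult_left_mono[OF u[of "s n"], of "norm z"] by simp
  \<comment> \<open>The norm is weakly lower semicontinuous: the limit is tested against itself.\<close>
  ultimately have "norm z * norm z \<le> norm z * r"
    by (metis LIMSEQ_le_const2 power2_norm_eq_inner power2_eq_square)
  then have "norm z \<le> r" using r by (cases "z = 0") auto
  moreover have "Q x \<le> Q z" if "norm x \<le> r" for x
  proof -
    have "ereal (Q x) \<le> Sup V" using that by (auto simp: V_def intro: Sup_upper)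
    then show ?thesis using sup order_trans by fastforce
  qed
  ultimately show ?thesis by blast
qed

text \<open>
  The squared norm is weakly lower semicontinuous because it lies above its tangent at the weak
  limit \<open>x\<close>, \<open>(norm y)\<^sup>2 \<ge> 2 * inner x y - (norm x)\<^sup>2\<close>, and this tangent is weakly continuous in \<open>y\<close>.
\<close>

lemma seq_weakly_usc_minus_half_norm_square:
  fixes P :: "'a::real_inner \<Rightarrow> real"
  assumes "seq_weakly_usc P"
  shows "seq_weakly_usc (\<lambda>x. P x - (norm x)\<^sup>2 / 2)"
  unfolding seq_weakly_usc_def
proof (intro allI impI)
  fix u :: "nat \<Rightarrow> 'a" and x assume ux: "weakly_converges u x"
  have P: "limsup (\<lambda>n. ereal (P (u n))) \<le> ereal (P x)"
    using assms ux by (auto simp: seq_weakly_usc_def)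
  have inn: "(\<lambda>n. inner x (u n)) \<longlonglongrightarrow> inner x x"
    using ux bounded_linear_inner_right unfolding weakly_converges_def by blast
  show "limsup (\<lambda>n. ereal (P (u n) - (norm (u n))\<^sup>2 / 2)) \<le> ereal (P x - (norm x)\<^sup>2 / 2)"
  proof (rule ereal_le_epsilon2)
    fix e :: real assume e: "e > 0"
    have "ereal (P x) < ereal (P x + e / 2)" using e by simp
    then have "\<forall>\<^sub>F n in sequentially. ereal (P (u n)) < ereal (P x + e / 2)"
      using P unfolding Limsup_le_iff by blast
    moreover have "\<forall>\<^sub>F n in sequentially. inner x (u n) > inner x x - e / 2"
      by (rule order_tendstoD(1)[OF inn]) (use e in simp)
    ultimately have "\<forall>\<^sub>F n in sequentially.
        ereal (P (u n) - (norm (u n))\<^sup>2 / 2) \<le> ereal (P x - (norm x)\<^sup>2 / 2 + e)"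
    proof eventually_elim
      case (elim n)
      have "0 \<le> inner (u n - x) (u n - x)" by simp
      then have "2 * inner x (u n) - inner x x \<le> (norm (u n))\<^sup>2"
        by (simp add: power2_norm_eq_inner inner_simps inner_commute)
      with elim show ?case by (simp add: power2_norm_eq_inner field_simps)
    qed
    then show "limsup (\<lambda>n. ereal (P (u n) - (norm (u n))\<^sup>2 / 2))
        \<le> ereal (P x - (norm x)\<^sup>2 / 2) + ereal e"
      by (simp add: Limsup_bounded)
  qed
qed

lemma potential_of_minus_half_norm_square:
  assumes "potential_of P A"
  shows "potential_of (\<lambda>x. P x - (norm x)\<^sup>2 / 2) (\<lambda>x. A x - x)"
  unfolding potential_of_def has_gateaux_derivative_def
proof (intro allI conjI)
  fix x h
  show "bounded_linear (\<lambda>h. inner (A x - x) h)" by (rule bounded_linear_inner_right)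
  have "((\<lambda>t. (P (x + t *\<^sub>R h) - P x) / t) \<longlongrightarrow> inner (A x) h) (at 0)"
    using assms unfolding potential_of_def has_gateaux_derivative_def by blast
  moreover have "((\<lambda>t::real. inner x h + t * inner h h / 2) \<longlongrightarrow> inner x h + 0 * inner h h / 2) (at 0)"
    by (intro tendsto_intros) simp
  ultimately have lim: "((\<lambda>t. (P (x + t *\<^sub>R h) - P x) / t - (inner x h + t * inner h h / 2))
      \<longlongrightarrow> inner (A x) h - (inner x h + 0 * inner h h / 2)) (at 0)"
    by (rule tendsto_diff)
  have "((\<lambda>t. (P (x + t *\<^sub>R h) - (norm (x + t *\<^sub>R h))\<^sup>2 / 2 - (P x - (norm x)\<^sup>2 / 2)) / t)
      \<longlongrightarrow> inner (A x) h - (inner x h + 0 * inner h h / 2)) (at 0)"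
  proof (rule Lim_transform_eventually[OF lim])
    show "\<forall>\<^sub>F t in at 0. (P (x + t *\<^sub>R h) - P x) / t - (inner x h + t * inner h h / 2) =
        (P (x + t *\<^sub>R h) - (norm (x + t *\<^sub>R h))\<^sup>2 / 2 - (P x - (norm x)\<^sup>2 / 2)) / t"
      by (rule eventually_mono[OF eventually_neq_at_within[of 0]])
        (simp add: power2_norm_eq_inner inner_simps inner_commute field_simps)
  qed
  then show "((\<lambda>t. (P (x + t *\<^sub>R h) - (norm (x + t *\<^sub>R h))\<^sup>2 / 2 - (P x - (norm x)\<^sup>2 / 2)) / t)
      \<longlongrightarrow> inner (A x - x) h) (at 0)"
    by (simp add: inner_diff_left)
qed

text \<open>
  At an interior maximum every directional derivative is nonpositive. In the direction of the
  gradient itself, this derivative is the squared norm of the gradient.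
\<close>

lemma potential_gradient_zero_at_interior_max:
  assumes pot: "potential_of Q B" and z: "norm z < r"
    and max: "\<And>x. norm x \<le> r \<Longrightarrow> Q x \<le> Q z"
  shows "B z = 0"
proof -
  have lim: "((\<lambda>t. (Q (z + t *\<^sub>R B z) - Q z) / t) \<longlongrightarrow> inner (B z) (B z)) (at_right 0)"
    using pot filterlim_at_split unfolding potential_of_def has_gateaux_derivative_def by blast
  have "((\<lambda>t. norm (z + t *\<^sub>R B z)) \<longlongrightarrow> norm (z + 0 *\<^sub>R B z)) (at_right 0)"
    by (intro tendsto_intros)
  then have "\<forall>\<^sub>F t in at_right 0. norm (z + t *\<^sub>R B z) < r"
    by (rule order_tendstoD(2)) (use z in simp)
  with eventually_at_right_less[of "0::real"]
  have "\<forall>\<^sub>F t in at_right 0. (Q (z + t *\<^sub>R B z) - Q z) / t \<le> 0"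
    by eventually_elim (use max in \<open>simp add: divide_nonpos_pos\<close>)
  then have "inner (B z) (B z) \<le> 0"
    using tendsto_upperbound[OF lim] by simp
  then show ?thesis using inner_gt_zero_iff[of "B z"] by (simp add: not_less[symmetric])
qed

section \<open>Growth on large balls\<close>

lemma exists_large_radius_small_growth:
  assumes "Liminf at_top (sup_growth P) < ereal a"
  shows "\<exists>c<a. \<forall>R. \<exists>r>R. \<forall>x. norm x \<le> r \<longrightarrow> P x \<le> c * r\<^sup>2"
proof -
  obtain y where y: "y < ereal a" and fr: "\<not> (\<forall>\<^sub>F r in at_top. y < sup_growth P r)"
    using assms unfolding not_le[symmetric] le_Liminf_iff by blast
  obtain c where yc: "y < ereal c" and ca: "c < a"
    using ereal_dense2[OF y] by auto
  have "\<exists>r>R. \<forall>x. norm x \<le> r \<longrightarrow> P x \<le> c * r\<^sup>2" for R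
  proof -
    obtain r where r: "r > max R 0" and "\<not> y < sup_growth P r"
      using fr eventually_at_top_dense[of "\<lambda>r. y < sup_growth P r"] by blast
    then have le: "(SUP x\<in>{x. norm x \<le> r}. ereal (P x)) / ereal (r\<^sup>2) \<le> ereal c"
      using yc by (auto simp: sup_growth_def)
    have "P x \<le> c * r\<^sup>2" if "norm x \<le> r" for x
    proof -
      have "ereal (P x) \<le> (SUP x\<in>{x. norm x \<le> r}. ereal (P x))"
        using that by (auto intro: SUP_upper)
      also have "\<dots> \<le> ereal (r\<^sup>2) * ereal c"
        using le r by (subst (asm) ereal_divide_le_pos) auto
      finally show ?thesis by (simp add: mult.commute)
    qed
    with r show ?thesis by auto
  qed
  with ca show ?thesis by blast
qed

lemma exists_large_radius_large_growth:
  assumes "ereal a < Limsup at_top (sup_growth P)"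
  shows "\<exists>c>a. \<forall>R. \<exists>r>R. \<exists>x. norm x \<le> r \<and> c * r\<^sup>2 < P x"
proof -
  obtain y where y: "ereal a < y" and fr: "\<not> (\<forall>\<^sub>F r in at_top. sup_growth P r < y)"
    using assms unfolding not_le[symmetric] Limsup_le_iff by blast
  obtain c where yc: "ereal c < y" and ca: "a < c"
    using ereal_dense2[OF y] by auto
  have "\<exists>r>R. \<exists>x. norm x \<le> r \<and> c * r\<^sup>2 < P x" for R
  proof -
    obtain r where r: "r > max R 0" and "\<not> sup_growth P r < y"
      using fr eventually_at_top_dense[of "\<lambda>r. sup_growth P r < y"] by blast
    then have "ereal c < (SUP x\<in>{x. norm x \<le> r}. ereal (P x)) / ereal (r\<^sup>2)"
      using yc by (auto simp: sup_growth_def)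
    then have "ereal (r\<^sup>2) * ereal c < (SUP x\<in>{x. norm x \<le> r}. ereal (P x))"
      using r by (subst (asm) ereal_less_divide_pos) auto
    then obtain x where "norm x \<le> r" "ereal (r\<^sup>2) * ereal c < ereal (P x)"
      by (auto simp: less_SUP_iff)
    with r show ?thesis by (auto simp: mult.commute)
  qed
  with ca show ?thesis by blast
qed

lemma exists_large_square_multiple:
  fixes d M :: real
  assumes "d > 0"
  shows "\<exists>R\<ge>0. \<forall>r>R. M < d * r\<^sup>2"
proof -
  have "M < d * r\<^sup>2" if r: "r > max 1 (M / d)" for r
  proof -
    have "M < d * r" using r assms by (simp add: field_simps)
    also have "\<dots> \<le> d * r\<^sup>2"
      using r assms by (intro mult_left_mono) (auto simp: power2_eq_square)
    finally show ?thesis .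
  qed
  then show ?thesis by (intro exI[of _ "max 1 (M / d)"]) auto
qed

section \<open>Unboundedness of the fixed point set\<close>

theorem theoremA:
  fixes A :: "'a::{real_inner, complete_space} \<Rightarrow> 'a" and P :: "'a \<Rightarrow> real"
  assumes "potential_operator A"
    and "potential_of P A"
    and "seq_weakly_usc P"
    and "Liminf at_top (sup_growth P) < ereal (1/2)"
    and "ereal (1/2) < Limsup at_top (sup_growth P)"
  shows "\<not> bounded {x. A x = x}"
proof
  define Q where "Q x = P x - (norm x)\<^sup>2 / 2" for x
  have usc: "seq_weakly_usc Q"
    unfolding Q_def by (rule seq_weakly_usc_minus_half_norm_square[OF assms(3)])
  have pot: "potential_of Q (\<lambda>x. A x - x)"
    unfolding Q_def by (rule potential_of_minus_half_norm_square[OF assms(2)])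
  assume "bounded {x. A x = x}"
  then obtain R where R: "R > 0" and fix_R: "\<And>x. A x = x \<Longrightarrow> norm x \<le> R"
    by (auto simp: bounded_pos)
  \<comment> \<open>\<open>Q m\<close> bounds \<open>Q\<close> at all fixed points; the proof produces a fixed point with a larger value.\<close>
  obtain m where m: "\<And>x. norm x \<le> R \<Longrightarrow> Q x \<le> Q m"
    using seq_weakly_usc_attains_max_on_cball[OF usc, of R] R by auto
  obtain c' where c': "c' > 1/2" and large: "\<And>R. \<exists>r>R. \<exists>x. norm x \<le> r \<and> c' * r\<^sup>2 < P x"
    using exists_large_radius_large_growth[OF assms(5)] by blast
  obtain c where c: "c < 1/2" and small: "\<And>R. \<exists>r>R. \<forall>x. norm x \<le> r \<longrightarrow> P x \<le> c * r\<^sup>2"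
    using exists_large_radius_small_growth[OF assms(4)] by blast
  obtain x where x: "Q x > Q m"
  proof -
    obtain R1 where R1: "R1 \<ge> 0" "\<And>r. r > R1 \<Longrightarrow> Q m < (c' - 1/2) * r\<^sup>2"
      using exists_large_square_multiple[of "c' - 1/2" "Q m"] c' by auto
    obtain r x where r: "r > R1" and x: "norm x \<le> r" "c' * r\<^sup>2 < P x"
      using large by blast
    have "(norm x)\<^sup>2 \<le> r\<^sup>2" using x by (intro power_mono) auto
    then have "Q m < Q x" using R1(2)[OF r] x by (simp add: Q_def algebra_simps)
    then show ?thesis by (rule that)
  qed
  \<comment> \<open>Beyond \<open>R2\<close>, the bound \<open>(c - 1/2) r\<^sup>2\<close> for \<open>Q\<close> on a sphere of small growth lies below \<open>Q x\<close>.\<close>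
  obtain R2 where R2: "R2 \<ge> 0" "\<And>r. r > R2 \<Longrightarrow> - Q x < (1/2 - c) * r\<^sup>2"
    using exists_large_square_multiple[of "1/2 - c" "- Q x"] c by auto
  obtain r where r: "r > max R2 (norm x)" and Pr: "\<And>x. norm x \<le> r \<Longrightarrow> P x \<le> c * r\<^sup>2"
    using small by blast
  obtain z where zr: "norm z \<le> r" and z: "\<And>y. norm y \<le> r \<Longrightarrow> Q y \<le> Q z"
    using seq_weakly_usc_attains_max_on_cball[OF usc, of r] r R2 by auto
  have Qz: "Q x \<le> Q z" using z r by simp
  have "norm z \<noteq> r"
  proof
    assume "norm z = r"
    then have "Q z \<le> c * r\<^sup>2 - r\<^sup>2 / 2" using Pr[OF zr] by (simp add: Q_def)
    with Qz R2(2)[of r] r show False by (simp add: algebra_simps)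
  qed
  with zr have "A z - z = 0"
    using potential_gradient_zero_at_interior_max[OF pot _ z, where r=r] by simp
  then have "Q z \<le> Q m" by (intro m fix_R) simp
  with Qz x show False by simp
qed

end
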